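(* Let $N, M, K$ be positive integers with $N=K$, let $N_r = NM$ with $N<N_r$, let $\rho>0$, and let $\mathbf{H}\in\mathbb{C}^{N_r\times K}$. For $n=1,\ldots,N$ let $\mathbf{w}_n\in\mathbb{C}^{M\times 1}$ be a vector all of whose entries have modulus $1/\sqrt{M}$, let $\mathbf{W}\in\mathbb{C}^{N_r\times N}$ be the block-diagonal matrix with diagonal blocks $\mathbf{w}_1,\ldots,\mathbf{w}_N$, and let $\mathbf{H}_n\in\mathbb{C}^{M\times K}$ be the sub-matrix of $\mathbf{H}$ consisting of rows $M(n-1)+1,\ldots,Mn$. Let $$R_{\mathrm{ESA}}=\log_2\det\left(\mathbf{I}_K+\rho\,\mathbf{H}^H\mathbf{W}\mathbf{W}^H\mathbf{H}\right).$$ Let $\mathbf{G}_n=\mathbf{H}_n^H\mathbf{w}_n\mathbf{w}_n^H\mathbf{H}_n$ for $n=1,\ldots,N$, $\mathbf{Q}_0=\mathbf{I}_K$, $\mathbf{Q}_{n-1}=\mathbf{Q}_{n-2}+\rho\,\mathbf{G}_{n-1}$ for $n=2,\ldots,N$, and $\mathbf{T}_n=\mathbf{H}_n\mathbf{Q}_{n-1}^{-1}\mathbf{H}_n^H$ for $n=1,\ldots,N$. Let $\sigma_1(n)$ be the largest eigenvalue of the positive semidefinite Hermitian matrix $\mathbf{T}_n$. Then $$R_{\mathrm{ESA}}\;\le\;\sum_{n=1}^{N}\log_2\left(1+\rho\,\sigma_1(n)\right)\;\le\;N\log_2\left(1+\frac{\rho}{N}\sum_{n=1}^{N}\sigma_1(n)\right).$$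 Moreover, equality holds in the first inequality when, for every $n=1,\ldots,N$, $\mathbf{w}_n$ is a unit-norm eigenvector of $\mathbf{T}_n$ corresponding to its largest eigenvalue $\sigma_1(n)$, and equality holds in the second inequality when $\sigma_1(1)=\sigma_1(2)=\cdots=\sigma_1(N)$.
   Context: $(\cdot)^H$ denotes conjugate transpose and $\mathbf{I}_K$ the $K\times K$ identity matrix. The block-diagonal matrix $\mathbf{W}$ has as its $n$th column the vector whose entries in positions $M(n-1)+1,\ldots,Mn$ are those of $\mathbf{w}_n$ and whose other entries are zero. Interpretation: $\mathbf{H}$ is the channel matrix between $K$ single-antenna users and a receiver with $N_r$ antennas divided into $N$ equal sub-arrays of $M$ antennas each (the "equal sub-array", ESA, architecture); $\mathbf{W}$ is the analog combining matrix; $R_{\mathrm{ESA}}$ is the total achievable rate; $\rho=1/N_0$, where $N_0>0$ is the noise power. *)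

theory Defs
  imports "Jordan_Normal_Form.Spectral_Radius" "Jordan_Normal_Form.Gauss_Jordan_Elimination"
begin

text \<open>
  The family \<open>w\<close> and the sub-arrays are numbered from \<open>1\<close> to \<open>N\<close>; rows and columns of
  matrices are numbered from \<open>0\<close>, so the rows \<open>M (n - 1) + 1, \<dots>, M n\<close> of \<open>H\<close> are the rows
  \<open>M * (n - 1), \<dots>, M * n - 1\<close>, and column \<open>j\<close> of the block-diagonal matrix carries
  \<open>w (j + 1)\<close>.
\<close>

definition combiner :: "nat \<Rightarrow> nat \<Rightarrow> (nat \<Rightarrow> complex vec) \<Rightarrow> complex mat" where
  "combiner M N w = mat (N * M) N
     (\<lambda>(i, j). if M * j \<le> i \<and> i < M * (j + 1) then w (j + 1) $ (i - M * j) else 0)"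

definition subarray :: "nat \<Rightarrow> complex mat \<Rightarrow> nat \<Rightarrow> complex mat" where
  "subarray M H n = mat M (dim_col H) (\<lambda>(i, j). H $$ (M * (n - 1) + i, j))"

definition col_mat :: "'a vec \<Rightarrow> 'a mat" where
  "col_mat v = mat_of_cols (dim_vec v) [v]"

text \<open>The matrix under the determinant is Hermitian, so \<open>Re\<close> discards nothing;
  see \<open>rate_det_real\<close> below.\<close>

definition rate_ESA :: "nat \<Rightarrow> nat \<Rightarrow> nat \<Rightarrow> real \<Rightarrow> complex mat \<Rightarrow> (nat \<Rightarrow> complex vec) \<Rightarrow> real" where
  "rate_ESA M N K \<rho> H w =
     log 2 (Re (det (1\<^sub>m K + complex_of_real \<rho> \<cdot>\<^sub>m
       (mat_adjoint H * combiner M N w * mat_adjoint (combiner M N w) * H))))"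

definition G_mat :: "nat \<Rightarrow> complex mat \<Rightarrow> (nat \<Rightarrow> complex vec) \<Rightarrow> nat \<Rightarrow> complex mat" where
  "G_mat M H w n =
     mat_adjoint (subarray M H n) * col_mat (w n) * mat_adjoint (col_mat (w n)) * subarray M H n"

primrec Q_mat ::
  "nat \<Rightarrow> nat \<Rightarrow> real \<Rightarrow> complex mat \<Rightarrow> (nat \<Rightarrow> complex vec) \<Rightarrow> nat \<Rightarrow> complex mat" where
  "Q_mat M K \<rho> H w 0 = 1\<^sub>m K"
| "Q_mat M K \<rho> H w (Suc n) = Q_mat M K \<rho> H w n + complex_of_real \<rho> \<cdot>\<^sub>m G_mat M H w (Suc n)"

text \<open>For \<open>\<rho> \<ge> 0\<close> every \<open>Q_mat\<close> is the identity plus a positive semidefinite matrix, hence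
  invertible, so \<open>mat_inverse\<close> does not return \<open>None\<close>.\<close>

definition T_mat ::
  "nat \<Rightarrow> nat \<Rightarrow> real \<Rightarrow> complex mat \<Rightarrow> (nat \<Rightarrow> complex vec) \<Rightarrow> nat \<Rightarrow> complex mat" where
  "T_mat M K \<rho> H w n =
     subarray M H n * the (mat_inverse (Q_mat M K \<rho> H w (n - 1))) * mat_adjoint (subarray M H n)"

text \<open>For a Hermitian matrix all eigenvalues are real and this is the largest of them;
  see \<open>largest_eigenvalue_hermitian\<close> below.\<close>

definition largest_eigenvalue :: "complex mat \<Rightarrow> real" where
  "largest_eigenvalue A = Max (Re ` spectrum A)"

definition sigma1 ::
  "nat \<Rightarrow> nat \<Rightarrow> real \<Rightarrow> complex mat \<Rightarrow> (nat \<Rightarrow> complex vec) \<Rightarrow> nat \<Rightarrow> real" where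
  "sigma1 M K \<rho> H w n = largest_eigenvalue (T_mat M K \<rho> H w n)"


lemma mat_adjoint_index:
  "mat_adjoint A \<in> carrier_mat (dim_col A) (dim_row A)"
  "i < dim_col A \<Longrightarrow> j < dim_row A \<Longrightarrow> mat_adjoint A $$ (i, j) = conjugate (A $$ (j, i))"
  unfolding mat_adjoint_def by (auto simp: mat_of_rows_def)

lemma hermitian_det_real:
  fixes A :: "complex mat"
  assumes A: "A \<in> carrier_mat n n" and herm: "mat_adjoint A = A"
  shows "det A \<in> \<real>"
proof -
  interpret cnj: comm_ring_hom cnj by unfold_locales auto
  have eq: "A = map_mat cnj (transpose_mat A)"
  proof (rule eq_matI)
    fix i j assume "i < dim_row (map_mat cnj (transpose_mat A))"
      "j < dim_col (map_mat cnj (transpose_mat A))"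
    then show "A $$ (i, j) = map_mat cnj (transpose_mat A) $$ (i, j)"
      using mat_adjoint_index(2)[of i A j] A herm by auto
  qed (use A in auto)
  have "det A = cnj (det (transpose_mat A))"
    by (subst eq) (rule cnj.hom_det)
  then have "det A = cnj (det A)" using det_transpose[OF A] by simp
  then show ?thesis by (metis Reals_cnj_iff)
qed

lemma hermitian_eigenvalue_real:
  fixes A :: "complex mat"
  assumes A: "A \<in> carrier_mat n n" and herm: "mat_adjoint A = A" and ev: "eigenvalue A k"
  shows "k \<in> \<real>"
proof -
  obtain v where v: "v \<in> carrier_vec n" "v \<noteq> 0\<^sub>v n" "A *\<^sub>v v = k \<cdot>\<^sub>v v"
    using ev A unfolding eigenvalue_def eigenvector_def by auto
  define s where "s = v \<bullet>c v"
  have s0: "s \<noteq> 0" using v unfolding s_def by simp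
  have cs: "cnj s = s"
    unfolding s_def using v(1)
    by (simp add: scalar_prod_def mult.commute)
  have entry: "cnj (A $$ (j, i)) = A $$ (i, j)" if "i < n" "j < n" for i j
    using mat_adjoint_index(2)[of i A j] A herm that by auto
  have q: "(A *\<^sub>v v) \<bullet>c v = (\<Sum>i<n. \<Sum>j<n. A $$ (i, j) * v $ j * cnj (v $ i))"
    using v(1) A by (auto simp: scalar_prod_def sum_distrib_right atLeast0LessThan intro!: sum.cong)
  have "cnj ((A *\<^sub>v v) \<bullet>c v) = (\<Sum>i<n. \<Sum>j<n. A $$ (j, i) * v $ i * cnj (v $ j))"
    unfolding q by (auto simp: entry intro!: sum.cong)
  also have "\<dots> = (A *\<^sub>v v) \<bullet>c v" unfolding q by (rule sum.swap)
  finally have "cnj ((A *\<^sub>v v) \<bullet>c v) = (A *\<^sub>v v) \<bullet>c v" .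
  moreover have "(A *\<^sub>v v) \<bullet>c v = k * s" unfolding v(3) s_def using v(1) by simp
  ultimately have "cnj k = k" using s0 cs by simp
  then show ?thesis by (simp add: Reals_cnj_iff)
qed

lemma largest_eigenvalue_hermitian:
  assumes A: "A \<in> carrier_mat n n" and n: "0 < n" and herm: "mat_adjoint A = A"
  shows "eigenvalue A (complex_of_real (largest_eigenvalue A))"
    and "eigenvalue A k \<Longrightarrow> k \<in> \<real> \<and> Re k \<le> largest_eigenvalue A"
proof -
  have fin: "finite (Re ` spectrum A)" using card_finite_spectrum[OF A] by simp
  have ne: "Re ` spectrum A \<noteq> {}" using spectrum_non_empty[OF A n] by simp
  have "largest_eigenvalue A \<in> Re ` spectrum A"
    unfolding largest_eigenvalue_def by (rule Max_in[OF fin ne])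
  then obtain l where l: "eigenvalue A l" "largest_eigenvalue A = Re l"
    unfolding spectrum_def by auto
  then show "eigenvalue A (complex_of_real (largest_eigenvalue A))"
    using hermitian_eigenvalue_real[OF A herm l(1)] by simp
  assume "eigenvalue A k"
  then show "k \<in> \<real> \<and> Re k \<le> largest_eigenvalue A"
    using hermitian_eigenvalue_real[OF A herm] Max_ge[OF fin]
    unfolding largest_eigenvalue_def spectrum_def by auto
qed

lemma rate_det_real:
  assumes H: "H \<in> carrier_mat (N * M) K"
  shows "det (1\<^sub>m K + complex_of_real \<rho> \<cdot>\<^sub>m
    (mat_adjoint H * combiner M N w * mat_adjoint (combiner M N w) * H)) \<in> \<real>"
proof -
  define W where "W = combiner M N w"
  define B where "B = mat_adjoint H * W"
  have W: "W \<in> carrier_mat (N * M) N" unfolding W_def combiner_def by simp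
  have H': "mat_adjoint H \<in> carrier_mat K (N * M)" using mat_adjoint_index(1)[of H] H by simp
  have W': "mat_adjoint W \<in> carrier_mat N (N * M)" using mat_adjoint_index(1)[of W] W by simp
  have B: "B \<in> carrier_mat K N" unfolding B_def using H' W by simp
  have B': "mat_adjoint B \<in> carrier_mat N K" using mat_adjoint_index(1)[of B] B by simp
  have WH: "mat_adjoint W * H = mat_adjoint B"
  proof (rule eq_matI)
    fix i j assume "i < dim_row (mat_adjoint B)" "j < dim_col (mat_adjoint B)"
    then have ij: "i < N" "j < K" using B' by auto
    show "(mat_adjoint W * H) $$ (i, j) = mat_adjoint B $$ (i, j)"
      using ij H W H' W' B
      by (auto simp: mat_adjoint_index(2) B_def scalar_prod_def mult.commute intro!: sum.cong)
  qed (use B' W' H in auto)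
  have eq: "mat_adjoint H * W * mat_adjoint W * H = B * mat_adjoint B"
    unfolding WH[symmetric] B_def[symmetric] using B W' H by (simp add: assoc_mult_mat)
  define A where "A = 1\<^sub>m K + complex_of_real \<rho> \<cdot>\<^sub>m (B * mat_adjoint B)"
  have A: "A \<in> carrier_mat K K" unfolding A_def using B B' by simp
  have "mat_adjoint A = A"
  proof (rule eq_matI)
    fix i j assume "i < dim_row A" "j < dim_col A"
    then have ij: "i < K" "j < K" using A by auto
    show "mat_adjoint A $$ (i, j) = A $$ (i, j)"
      using ij A B B'
      by (auto simp: mat_adjoint_index(2) A_def scalar_prod_def mult.commute intro!: sum.cong)
  qed (use A mat_adjoint_index(1)[of A] in auto)
  from hermitian_det_real[OF A this] show ?thesis
    unfolding A_def eq[unfolded W_def] .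
qed

end

theory Submission
  imports Defs "HOL-Analysis.Convex"
begin

text \<open>
  Since \<open>Q n = Q (n - 1) + \<rho> U U^H\<close> with \<open>U = H_n^H w_n\<close>, the identity
  \<open>det (I + A B) = det (I + B A)\<close> gives \<open>det (Q n) = det (Q (n - 1)) (1 + \<rho> w_n^H T_n w_n)\<close>.
  The matrix under the determinant in the rate is \<open>Q N\<close>, so the rate is the sum of the
  \<open>log 2 (1 + \<rho> w_n^H T_n w_n)\<close>, and the first inequality is the Rayleigh bound for the unit
  vectors \<open>w_n\<close>; the second one is concavity of the logarithm.

  The Rayleigh bound needs neither compactness nor a unitary diagonalisation: let \<open>\<mu>\<close> be the
  infimum of all \<open>t\<close> with \<open>(A x, x) \<le> t (x, x)\<close> for every \<open>x\<close>. If the positive semidefinite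
  matrix \<open>\<mu> I - A\<close> were nonsingular, its form would be bounded below by a positive multiple of
  \<open>(x, x)\<close>, and \<open>\<mu>\<close> could be lowered. So \<open>\<mu>\<close> is an eigenvalue of \<open>A\<close>.
\<close>

section \<open>Adjoints and the Hermitian inner product\<close>

lemma cscalar_prod_self:
  fixes x :: "complex vec"
  shows "x \<bullet>c x = complex_of_real (\<Sum>i<dim_vec x. (cmod (x $ i))\<^sup>2)"
  by (simp add: scalar_prod_def atLeast0LessThan complex_norm_square del: of_real_power)

lemma cscalar_prod_cnj:
  fixes x y :: "complex vec"
  assumes "x \<in> carrier_vec n" "y \<in> carrier_vec n"
  shows "cnj (x \<bullet>c y) = y \<bullet>c x"
  using assms by (simp add: scalar_prod_def mult.commute)

lemma mat_adjoint_carrier: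
  assumes "A \<in> carrier_mat m n"
  shows "mat_adjoint A \<in> carrier_mat n m"
  using mat_adjoint_index(1)[of A] assms by simp

lemma mat_adjoint_adjoint:
  fixes A :: "complex mat"
  shows "mat_adjoint (mat_adjoint A) = A"
proof -
  have A': "mat_adjoint A \<in> carrier_mat (dim_col A) (dim_row A)"
    by (rule mat_adjoint_index(1))
  show ?thesis
    by (rule eq_matI)
      (use A' mat_adjoint_carrier[OF A'] in \<open>auto simp: mat_adjoint_index(2)\<close>)
qed

lemma mat_adjoint_one: "mat_adjoint (1\<^sub>m n :: complex mat) = 1\<^sub>m n"
  by (rule eq_matI)
    (use mat_adjoint_carrier[of "1\<^sub>m n :: complex mat" n n] in \<open>auto simp: mat_adjoint_index(2)\<close>)

lemma mat_adjoint_mult: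
  fixes A B :: "complex mat"
  assumes A: "A \<in> carrier_mat m n" and B: "B \<in> carrier_mat n k"
  shows "mat_adjoint (A * B) = mat_adjoint B * mat_adjoint A"
proof (rule eq_matI)
  note AB = mat_adjoint_carrier[OF A] mat_adjoint_carrier[OF B]
    mat_adjoint_carrier[OF mult_carrier_mat[OF A B]]
  fix i j assume "i < dim_row (mat_adjoint B * mat_adjoint A)"
    "j < dim_col (mat_adjoint B * mat_adjoint A)"
  then have "i < k" "j < m" using AB by auto
  then show "mat_adjoint (A * B) $$ (i, j) = (mat_adjoint B * mat_adjoint A) $$ (i, j)"
    using A B AB
    by (auto simp: mat_adjoint_index(2) scalar_prod_def mult.commute intro!: sum.cong)
qed (use mat_adjoint_carrier[OF A] mat_adjoint_carrier[OF B]
    mat_adjoint_carrier[OF mult_carrier_mat[OF A B]] in auto)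

lemma cscalar_prod_mult_mat_vec:
  fixes A :: "complex mat"
  assumes A: "A \<in> carrier_mat m n" and x: "x \<in> carrier_vec n" and y: "y \<in> carrier_vec m"
  shows "(A *\<^sub>v x) \<bullet>c y = x \<bullet>c (mat_adjoint A *\<^sub>v y)"
proof -
  note A' = mat_adjoint_carrier[OF A]
  have "(A *\<^sub>v x) \<bullet>c y = (\<Sum>i<m. \<Sum>j<n. A $$ (i, j) * x $ j * cnj (y $ i))"
    using A x y by (auto simp: scalar_prod_def sum_distrib_right atLeast0LessThan intro!: sum.cong)
  also have "\<dots> = (\<Sum>j<n. \<Sum>i<m. A $$ (i, j) * x $ j * cnj (y $ i))" by (rule sum.swap)
  also have "\<dots> = x \<bullet>c (mat_adjoint A *\<^sub>v y)"
    using A A' x y by (auto simp: scalar_prod_def sum_distrib_left atLeast0LessThan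
        mat_adjoint_index(2) mult_ac intro!: sum.cong)
  finally show ?thesis .
qed

section \<open>Determinant identities and inverses\<close>

text \<open>The block matrices \<open>E\<close> and \<open>F\<close> are chosen so that both
  \<open>E * F\<close> and \<open>F * E\<close> are block lower triangular with an identity as one
  diagonal block. The other diagonal block is \<open>1 + A * B\<close> in the first product and
  \<open>1 + B * A\<close> in the second, and both products have the same determinant.\<close>

lemma det_one_plus_mult_commute:
  fixes A B :: "'a :: idom mat"
  assumes A: "A \<in> carrier_mat n m" and B: "B \<in> carrier_mat m n"
  shows "det (1\<^sub>m n + A * B) = det (1\<^sub>m m + B * A)"
proof -
  define E where "E = four_block_mat (1\<^sub>m n) A (0\<^sub>m m n) (1\<^sub>m m)"
  define F where "F = four_block_mat (1\<^sub>m n) (- A) B (1\<^sub>m m)"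
  have E: "E \<in> carrier_mat (n + m) (n + m)" and F: "F \<in> carrier_mat (n + m) (n + m)"
    unfolding E_def F_def by (rule four_block_carrier_mat; simp)+
  have detE: "det E = 1"
    unfolding E_def by (subst det_four_block_mat_lower_left_zero[OF _ A]) auto
  have mA: "- A \<in> carrier_mat n m" using A by simp
  have BA: "B * A \<in> carrier_mat m m" and AB: "A * B \<in> carrier_mat n n" using A B by auto
  have [simp]: "- A + A = 0\<^sub>m n m" "A + - A = 0\<^sub>m n m"
    "- 0\<^sub>m m m + (1\<^sub>m m :: 'a mat) = 1\<^sub>m m"
    by (rule eq_matI; use A in auto)+
  have "E * F = four_block_mat (1\<^sub>m n + A * B) (0\<^sub>m n m) B (1\<^sub>m m)"
    unfolding E_def F_def
    by (subst mult_four_block_mat[OF one_carrier_mat A zero_carrier_mat one_carrier_mat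
          one_carrier_mat mA B one_carrier_mat]) (use A B mA BA AB in simp)
  then have 1: "det (E * F) = det (1\<^sub>m n + A * B)"
    using det_four_block_mat_upper_right_zero[of "1\<^sub>m n + A * B" n "0\<^sub>m n m" m B "1\<^sub>m m"] A B by simp
  have "F * E = four_block_mat (1\<^sub>m n) (0\<^sub>m n m) B (1\<^sub>m m + B * A)"
    unfolding E_def F_def
    by (subst mult_four_block_mat[OF one_carrier_mat mA B one_carrier_mat
          one_carrier_mat A zero_carrier_mat one_carrier_mat])
      (use A B mA BA AB comm_add_mat[OF BA one_carrier_mat] in simp)
  then have 2: "det (F * E) = det (1\<^sub>m m + B * A)"
    using det_four_block_mat_upper_right_zero[of "1\<^sub>m n" n "0\<^sub>m n m" m B "1\<^sub>m m + B * A"] A B by simp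
  show ?thesis using 1 2 det_mult[OF E F] det_mult[OF F E] by (simp add: detE)
qed

lemma nonsingular_mat_inverse:
  fixes A :: "'a :: field mat"
  assumes A: "A \<in> carrier_mat n n" and "det A \<noteq> 0"
  shows "the (mat_inverse A) \<in> carrier_mat n n"
    and "A * the (mat_inverse A) = 1\<^sub>m n" and "the (mat_inverse A) * A = 1\<^sub>m n"
proof -
  \<comment> \<open>The argument \<open>()\<close> fills the extension slot of the matrix ring
    record, which both facts leave free and which has to agree for the two statements about units to
    meet.\<close>
  have "mat_inverse A \<noteq> None"
    using mat_inverse(1)[OF A, of "()"] det_non_zero_imp_unit[OF assms, of "()"] by argo
  then obtain B where "mat_inverse A = Some B" by auto
  then show "the (mat_inverse A) \<in> carrier_mat n n"
    "A * the (mat_inverse A) = 1\<^sub>m n" "the (mat_inverse A) * A = 1\<^sub>m n"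
    using mat_inverse(2)[OF A] by auto
qed

text \<open>Taking adjoints in \<open>B * A = 1\<close> shows that \<open>mat_adjoint B\<close> is a
  right inverse of \<open>A\<close>; it must coincide with the left inverse
  \<open>B\<close>.\<close>

lemma hermitian_inverse:
  fixes A :: "complex mat"
  assumes A: "A \<in> carrier_mat n n" and herm: "mat_adjoint A = A"
    and B: "B \<in> carrier_mat n n" and AB: "A * B = 1\<^sub>m n" and BA: "B * A = 1\<^sub>m n"
  shows "mat_adjoint B = B"
proof -
  note B' = mat_adjoint_carrier[OF B]
  have "A * mat_adjoint B = 1\<^sub>m n"
    using mat_adjoint_mult[OF B A] BA herm by (simp add: mat_adjoint_one)
  then have "B * (A * mat_adjoint B) = B" using B by simp
  then show ?thesis using assoc_mult_mat[OF B A B'] BA B' by simp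
qed

text \<open>Factoring out \<open>A\<close> leaves the determinant of the identity plus a product
  through dimension \<open>m\<close>, and commuting that product turns it into a determinant of size
  \<open>m\<close>. For a rank-one update this means size 1.\<close>

lemma det_add_smult_mult:
  fixes A :: "complex mat"
  assumes A: "A \<in> carrier_mat n n" and B: "B \<in> carrier_mat n n" and AB: "A * B = 1\<^sub>m n"
    and U: "U \<in> carrier_mat n m" and V: "V \<in> carrier_mat m n"
  shows "det (A + c \<cdot>\<^sub>m (U * V)) = det A * det (1\<^sub>m m + c \<cdot>\<^sub>m (V * B * U))"
proof -
  have BU: "B * U \<in> carrier_mat n m" using B U by simp
  have UV: "U * V \<in> carrier_mat n n" using U V by simp
  have "A * (B * (U * V)) = U * V" using assoc_mult_mat[OF A B UV] AB left_mult_one_mat[OF UV] by metis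
  then have "A + c \<cdot>\<^sub>m (U * V) = A * (1\<^sub>m n + c \<cdot>\<^sub>m (B * (U * V)))"
    using mult_add_distrib_mat[OF A one_carrier_mat, of "c \<cdot>\<^sub>m (B * (U * V))"]
      mult_smult_distrib[OF A, of "B * (U * V)" n c] A B UV by simp
  also have "det \<dots> = det A * det (1\<^sub>m n + c \<cdot>\<^sub>m (B * (U * V)))"
    by (rule det_mult[OF A]) (use B UV in simp)
  also have "c \<cdot>\<^sub>m (B * (U * V)) = (c \<cdot>\<^sub>m (B * U)) * V"
    using assoc_mult_mat[OF B U V] mult_smult_assoc_mat[OF BU V] by simp
  also have "det (1\<^sub>m n + c \<cdot>\<^sub>m (B * U) * V) = det (1\<^sub>m m + V * (c \<cdot>\<^sub>m (B * U)))"
    by (rule det_one_plus_mult_commute) (use BU V in auto)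
  also have "V * (c \<cdot>\<^sub>m (B * U)) = c \<cdot>\<^sub>m (V * B * U)"
    using mult_smult_distrib[OF V BU] assoc_mult_mat[OF V B U] by simp
  finally show ?thesis .
qed

section \<open>Bounds for quadratic forms and the Rayleigh bound\<close>

text \<open>Cauchy-Schwarz in each row gives the squared Frobenius norm as a bound; the added 1
  keeps the constant positive when \<open>A\<close> is zero.\<close>

lemma cscalar_prod_mult_mat_vec_bounded:
  fixes A :: "complex mat"
  assumes A: "A \<in> carrier_mat n n"
  obtains c where "c > 0"
    "\<And>x. x \<in> carrier_vec n \<Longrightarrow> Re ((A *\<^sub>v x) \<bullet>c (A *\<^sub>v x)) \<le> c * Re (x \<bullet>c x)"
proof
  let ?c = "(\<Sum>i<n. \<Sum>j<n. (cmod (A $$ (i, j)))\<^sup>2) + 1"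
  show "?c > 0" by (intro add_nonneg_pos sum_nonneg) auto
  fix x :: "complex vec" assume x: "x \<in> carrier_vec n"
  let ?s = "\<Sum>i<n. (cmod (x $ i))\<^sup>2"
  have s: "Re (x \<bullet>c x) = ?s" using x cscalar_prod_self[of x] by simp
  have "(cmod ((A *\<^sub>v x) $ i))\<^sup>2 \<le> (\<Sum>j<n. (cmod (A $$ (i, j)))\<^sup>2) * ?s" if i: "i < n" for i
  proof -
    have "(A *\<^sub>v x) $ i = (\<Sum>j<n. A $$ (i, j) * x $ j)"
      using A x i by (simp add: scalar_prod_def atLeast0LessThan)
    then have "cmod ((A *\<^sub>v x) $ i) \<le> (\<Sum>j<n. cmod (A $$ (i, j)) * cmod (x $ j))"
      by (metis (mono_tags, lifting) norm_mult norm_sum sum.cong)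
    then have "(cmod ((A *\<^sub>v x) $ i))\<^sup>2 \<le> (\<Sum>j<n. cmod (A $$ (i, j)) * cmod (x $ j))\<^sup>2"
      by (intro power_mono) auto
    also have "\<dots> \<le> (\<Sum>j<n. (cmod (A $$ (i, j)))\<^sup>2) * ?s"
      by (rule Cauchy_Schwarz_ineq_sum)
    finally show ?thesis .
  qed
  then have "(\<Sum>i<n. (cmod ((A *\<^sub>v x) $ i))\<^sup>2) \<le> (\<Sum>i<n. (\<Sum>j<n. (cmod (A $$ (i, j)))\<^sup>2) * ?s)"
    by (intro sum_mono) auto
  also have "\<dots> \<le> ?c * ?s" by (simp add: sum_distrib_right[symmetric] mult_right_mono sum_nonneg)
  finally have "(\<Sum>i<n. (cmod ((A *\<^sub>v x) $ i))\<^sup>2) \<le> ?c * ?s" .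
  then show "Re ((A *\<^sub>v x) \<bullet>c (A *\<^sub>v x)) \<le> ?c * Re (x \<bullet>c x)"
    using A s cscalar_prod_self[of "A *\<^sub>v x"] by simp
qed

lemma hermitian_form_real:
  fixes A :: "complex mat"
  assumes A: "A \<in> carrier_mat n n" and herm: "mat_adjoint A = A" and x: "x \<in> carrier_vec n"
  shows "(A *\<^sub>v x) \<bullet>c x = complex_of_real (Re ((A *\<^sub>v x) \<bullet>c x))"
proof -
  have "cnj ((A *\<^sub>v x) \<bullet>c x) = x \<bullet>c (A *\<^sub>v x)"
    by (rule cscalar_prod_cnj) (use A x in auto)
  also have "\<dots> = (A *\<^sub>v x) \<bullet>c x" using cscalar_prod_mult_mat_vec[OF A x x] herm by simp
  finally show ?thesis by (metis Reals_cnj_iff of_real_Re)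
qed

text \<open>The scalar is real, so it comes out of the conjugated argument unchanged. The expansion
  serves the two completion-of-squares arguments below, with \<open>t = -1\<close> and
  \<open>t = - 1 / c\<close>.\<close>

lemma cscalar_prod_add_smult:
  fixes x y :: "complex vec" and t :: real
  assumes x: "x \<in> carrier_vec n" and y: "y \<in> carrier_vec n"
    and a: "a \<in> carrier_vec n" and b: "b \<in> carrier_vec n"
  shows "(x + complex_of_real t \<cdot>\<^sub>v y) \<bullet>c (a + complex_of_real t \<cdot>\<^sub>v b)
    = x \<bullet>c a + t * (x \<bullet>c b) + t * (y \<bullet>c a) + t\<^sup>2 * (y \<bullet>c b)"
proof -
  have "(x + complex_of_real t \<cdot>\<^sub>v y) \<bullet>c (a + complex_of_real t \<cdot>\<^sub>v b)
    = (\<Sum>i<n. x $ i * cnj (a $ i) + t * (x $ i * cnj (b $ i)) + t * (y $ i * cnj (a $ i))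
        + t\<^sup>2 * (y $ i * cnj (b $ i)))"
    unfolding scalar_prod_def using assms
    by (intro sum.cong) (auto simp: algebra_simps power2_eq_square)
  also have "\<dots> = x \<bullet>c a + t * (x \<bullet>c b) + t * (y \<bullet>c a) + t\<^sup>2 * (y \<bullet>c b)"
    unfolding sum.distrib scalar_prod_def sum_distrib_left using assms
    by (simp add: atLeast0LessThan)
  finally show ?thesis .
qed

lemma Re_cscalar_prod_self_nonneg: "0 \<le> Re ((x :: complex vec) \<bullet>c x)"
  by (simp add: cscalar_prod_self sum_nonneg)

text \<open>Expanding 0 \<le> |x - A x|^2 gives 2 Re (A x, x) \<le> |x|^2 + |A x|^2, and the last
  term is at most c |x|^2. Hence the constant \<open>c + 1\<close>, with a factor 2 to
  spare.\<close>

lemma hermitian_form_bounded: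
  fixes A :: "complex mat"
  assumes A: "A \<in> carrier_mat n n"
  obtains c where "c > 0"
    "\<And>x. x \<in> carrier_vec n \<Longrightarrow> Re ((A *\<^sub>v x) \<bullet>c x) \<le> c * Re (x \<bullet>c x)"
proof -
  obtain c where c: "c > 0"
    "\<And>x. x \<in> carrier_vec n \<Longrightarrow> Re ((A *\<^sub>v x) \<bullet>c (A *\<^sub>v x)) \<le> c * Re (x \<bullet>c x)"
    using cscalar_prod_mult_mat_vec_bounded[OF A] by blast
  show ?thesis
  proof
    show "c + 1 > 0" using c(1) by simp
    fix x :: "complex vec" assume x: "x \<in> carrier_vec n"
    have Ax: "A *\<^sub>v x \<in> carrier_vec n" using A x by simp
    have "0 \<le> Re ((x + complex_of_real (-1) \<cdot>\<^sub>v (A *\<^sub>v x)) \<bullet>c (x + complex_of_real (-1) \<cdot>\<^sub>v (A *\<^sub>v x)))"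
      by (rule Re_cscalar_prod_self_nonneg)
    moreover have "Re (x \<bullet>c (A *\<^sub>v x)) = Re ((A *\<^sub>v x) \<bullet>c x)"
      using cscalar_prod_cnj[OF x Ax] by (metis complex_cnj(1) complex.sel(1) cnj.sel(1))
    ultimately have "2 * Re ((A *\<^sub>v x) \<bullet>c x) \<le> Re (x \<bullet>c x) + Re ((A *\<^sub>v x) \<bullet>c (A *\<^sub>v x))"
      unfolding cscalar_prod_add_smult[OF x Ax x Ax] by simp
    then show "Re ((A *\<^sub>v x) \<bullet>c x) \<le> (c + 1) * Re (x \<bullet>c x)"
      using c(2)[OF x] Re_cscalar_prod_self_nonneg[of x]
        mult_nonneg_nonneg[OF less_imp_le[OF c(1)] Re_cscalar_prod_self_nonneg[of x]]
      unfolding distrib_right by linarith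
  qed
qed

text \<open>Two estimates are chained: |x|^2 \<le> d |B x|^2, because x is recovered from B x by the
  bounded inverse \<open>C\<close>, and |B x|^2 \<le> c (B x, x), which is where positivity enters.
  The result is the constant \<open>1 / (c * d)\<close>.\<close>

lemma psd_nonsingular_imp_coercive:
  fixes B :: "complex mat"
  assumes B: "B \<in> carrier_mat n n" and herm: "mat_adjoint B = B"
    and psd: "\<And>x. x \<in> carrier_vec n \<Longrightarrow> 0 \<le> Re ((B *\<^sub>v x) \<bullet>c x)"
    and det: "det B \<noteq> 0"
  obtains e where "e > 0" "\<And>x. x \<in> carrier_vec n \<Longrightarrow> e * Re (x \<bullet>c x) \<le> Re ((B *\<^sub>v x) \<bullet>c x)"
proof -
  obtain C where C: "C \<in> carrier_mat n n" "C * B = 1\<^sub>m n"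
    using nonsingular_mat_inverse[OF B det] by blast
  obtain c where c: "c > 0"
    "\<And>x. x \<in> carrier_vec n \<Longrightarrow> Re ((B *\<^sub>v x) \<bullet>c x) \<le> c * Re (x \<bullet>c x)"
    using hermitian_form_bounded[OF B] by blast
  obtain d where d: "d > 0"
    "\<And>x. x \<in> carrier_vec n \<Longrightarrow> Re ((C *\<^sub>v x) \<bullet>c (C *\<^sub>v x)) \<le> d * Re (x \<bullet>c x)"
    using cscalar_prod_mult_mat_vec_bounded[OF C(1)] by blast
  show ?thesis
  proof
    show "1 / (c * d) > 0" using c d by simp
    fix x :: "complex vec" assume x: "x \<in> carrier_vec n"
    \<comment> \<open>Positivity of the form at \<open>x - B x / c\<close> gives \<open>|B x|^2 \<le> c (B x, x)\<close>.\<close>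
    define y where "y = B *\<^sub>v x"
    have y: "y \<in> carrier_vec n" and By: "B *\<^sub>v y \<in> carrier_vec n" unfolding y_def using B x by auto
    define z where "z = x + complex_of_real (- 1 / c) \<cdot>\<^sub>v y"
    have z: "z \<in> carrier_vec n" unfolding z_def using x y by simp
    have Bz: "B *\<^sub>v z = y + complex_of_real (- 1 / c) \<cdot>\<^sub>v (B *\<^sub>v y)"
      unfolding z_def y_def
      by (subst mult_add_distrib_mat_vec[OF B x]) (use B x in \<open>auto simp: mult_mat_vec\<close>)
    have "(B *\<^sub>v y) \<bullet>c x = y \<bullet>c y"
      using cscalar_prod_mult_mat_vec[OF B y x] herm unfolding y_def by simp
    then have "Re ((B *\<^sub>v z) \<bullet>c z)
      = Re (y \<bullet>c x) - 2 / c * Re (y \<bullet>c y) + 1 / c\<^sup>2 * Re ((B *\<^sub>v y) \<bullet>c y)"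
      unfolding Bz by (subst z_def, subst cscalar_prod_add_smult[OF y By x y])
        (simp add: power_divide flip: of_real_power)
    \<comment> \<open>The bound (B y, y) \<le> c |y|^2 makes the quadratic term absorb only half of
      the cross terms; this is why the step length is 1 / c.\<close>
    also have "\<dots> \<le> Re (y \<bullet>c x) - 2 / c * Re (y \<bullet>c y) + 1 / c\<^sup>2 * (c * Re (y \<bullet>c y))"
      by (intro add_left_mono mult_left_mono c(2)[OF y]) simp
    also have "\<dots> = Re (y \<bullet>c x) - Re (y \<bullet>c y) / c"
      using c(1) by (simp add: field_simps power2_eq_square)
    finally have "Re (y \<bullet>c y) \<le> c * Re (y \<bullet>c x)"
      using mult_nonneg_nonneg[OF less_imp_le[OF c(1)] psd[OF z]] c(1) by (simp add: field_simps)
    moreover have "C *\<^sub>v y = x"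
      unfolding y_def using assoc_mult_mat_vec[OF C(1) B x] C(2) x by simp
    then have "Re (x \<bullet>c x) \<le> d * Re (y \<bullet>c y)" using d(2)[OF y] by simp
    ultimately have "Re (x \<bullet>c x) \<le> d * (c * Re (y \<bullet>c x))"
      using d(1) by (meson mult_left_mono less_imp_le order_trans)
    then show "1 / (c * d) * Re (x \<bullet>c x) \<le> Re ((B *\<^sub>v x) \<bullet>c x)"
      using c(1) d(1) unfolding y_def[symmetric] by (simp add: field_simps)
  qed
qed

lemma smult_one_minus_mult_mat_vec:
  fixes A :: "'a :: field mat"
  assumes A: "A \<in> carrier_mat n n" and v: "v \<in> carrier_vec n"
  shows "(k \<cdot>\<^sub>m 1\<^sub>m n - A) *\<^sub>v v = k \<cdot>\<^sub>v v - A *\<^sub>v v"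
proof -
  have "(k \<cdot>\<^sub>m 1\<^sub>m n) *\<^sub>v v = k \<cdot>\<^sub>v v"
  proof (rule eq_vecI)
    fix i assume "i < dim_vec (k \<cdot>\<^sub>v v)"
    then have i: "i < n" using v by simp
    have "row (k \<cdot>\<^sub>m 1\<^sub>m n) i = k \<cdot>\<^sub>v unit_vec n i" using i by auto
    then show "((k \<cdot>\<^sub>m 1\<^sub>m n) *\<^sub>v v) $ i = (k \<cdot>\<^sub>v v) $ i" using i v by simp
  qed (use v in simp)
  then show ?thesis
    using minus_mult_distrib_mat_vec[of "k \<cdot>\<^sub>m 1\<^sub>m n" n n A v] A v by simp
qed

lemma eigenvalue_of_det_eq_0:
  fixes A :: "'a :: field mat"
  assumes A: "A \<in> carrier_mat n n" and det: "det (k \<cdot>\<^sub>m 1\<^sub>m n - A) = 0"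
  shows "eigenvalue A k"
proof -
  have "k \<cdot>\<^sub>m 1\<^sub>m n - A \<in> carrier_mat n n" using A by (rule minus_carrier_mat)
  then obtain v where v: "v \<in> carrier_vec n" "v \<noteq> 0\<^sub>v n" "(k \<cdot>\<^sub>m 1\<^sub>m n - A) *\<^sub>v v = 0\<^sub>v n"
    using det det_0_iff_vec_prod_zero by blast
  have eq: "k \<cdot>\<^sub>v v - A *\<^sub>v v = 0\<^sub>v n"
    using v smult_one_minus_mult_mat_vec[OF A v(1)] by simp
  have "A *\<^sub>v v = k \<cdot>\<^sub>v v"
  proof (rule eq_vecI)
    fix i assume "i < dim_vec (k \<cdot>\<^sub>v v)"
    then have i: "i < n" using v by simp
    have "(k \<cdot>\<^sub>v v - A *\<^sub>v v) $ i = 0" unfolding eq using i by simp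
    then show "(A *\<^sub>v v) $ i = (k \<cdot>\<^sub>v v) $ i" using i v(1) A by simp
  qed (use v(1) A in simp)
  then have "eigenvector A v k" using v(1,2) A by (simp add: eigenvector_def)
  then show ?thesis unfolding eigenvalue_def by (rule exI)
qed

lemma hermitian_form_le_largest_eigenvalue:
  fixes A :: "complex mat"
  assumes A: "A \<in> carrier_mat n n" and n: "0 < n" and herm: "mat_adjoint A = A"
    and x: "x \<in> carrier_vec n"
  shows "Re ((A *\<^sub>v x) \<bullet>c x) \<le> largest_eigenvalue A * Re (x \<bullet>c x)"
proof -
  define S where "S = {t. \<forall>x \<in> carrier_vec n. Re ((A *\<^sub>v x) \<bullet>c x) \<le> t * Re (x \<bullet>c x)}"
  define \<mu> where "\<mu> = Inf S"
  obtain c where "0 < c" and c: "\<And>x. x \<in> carrier_vec n \<Longrightarrow> Re ((A *\<^sub>v x) \<bullet>c x) \<le> c * Re (x \<bullet>c x)"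
    using hermitian_form_bounded[OF A] by blast
  from c have "c \<in> S" by (simp add: S_def)
  then have ne: "S \<noteq> {}" by (rule ex_in_conv[THEN iffD1, OF exI])
  have u: "unit_vec n 0 \<in> carrier_vec n" by simp
  have u1: "Re (unit_vec n 0 \<bullet>c unit_vec n 0) = 1"
    using n by (simp add: cscalar_prod_self if_distrib[of "\<lambda>z. (cmod z)\<^sup>2"] cong: if_cong)
  \<comment> \<open>The first unit vector exists and has norm 1 because \<open>0 < n\<close>;
    testing with it bounds every member of \<open>S\<close> below by the real part of the corner
    entry of \<open>A\<close>.\<close>
  have bdd: "bdd_below S"
  proof (rule bdd_belowI)
    fix t assume "t \<in> S"
    then have "Re ((A *\<^sub>v unit_vec n 0) \<bullet>c unit_vec n 0) \<le> t * Re (unit_vec n 0 \<bullet>c unit_vec n 0)"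
      using u unfolding S_def by blast
    then show "Re ((A *\<^sub>v unit_vec n 0) \<bullet>c unit_vec n 0) \<le> t" unfolding u1 by simp
  qed
  \<comment> \<open>The infimum itself satisfies the inequality that defines \<open>S\<close>: if
    (x, x) > 0, the Rayleigh quotient of x is a lower bound of \<open>S\<close>; if (x, x) = 0, the
    value of the factor is irrelevant and the member \<open>c\<close> of \<open>S\<close> gives the
    claim.\<close>
  have \<mu>: "Re ((A *\<^sub>v x) \<bullet>c x) \<le> \<mu> * Re (x \<bullet>c x)" if x: "x \<in> carrier_vec n" for x
  proof (cases "Re (x \<bullet>c x) = 0")
    case True
    have "Re ((A *\<^sub>v x) \<bullet>c x) \<le> c * Re (x \<bullet>c x)" using \<open>c \<in> S\<close> x by (simp add: S_def)
    then show ?thesis using True by simp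
  next
    case False
    then have pos: "Re (x \<bullet>c x) > 0" using Re_cscalar_prod_self_nonneg[of x] by simp
    have "Re ((A *\<^sub>v x) \<bullet>c x) / Re (x \<bullet>c x) \<le> \<mu>"
      unfolding \<mu>_def by (rule cInf_greatest[OF ne]) (use x pos in \<open>simp add: S_def pos_divide_le_eq\<close>)
    then show ?thesis using pos by (simp add: field_simps)
  qed
  define B where "B = complex_of_real \<mu> \<cdot>\<^sub>m 1\<^sub>m n - A"
  have B: "B \<in> carrier_mat n n" unfolding B_def using A by (rule minus_carrier_mat)
  have B_herm: "mat_adjoint B = B"
  proof (rule eq_matI)
    fix i j assume "i < dim_row B" "j < dim_col B"
    then have ij: "i < n" "j < n" using B by auto
    have "cnj (A $$ (j, i)) = A $$ (i, j)"
      using mat_adjoint_index(2)[of i A j] A herm ij by auto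
    then show "mat_adjoint B $$ (i, j) = B $$ (i, j)"
      using ij A B by (auto simp: mat_adjoint_index(2) B_def)
  qed (use B mat_adjoint_carrier[OF B] in auto)
  have form: "Re ((B *\<^sub>v x) \<bullet>c x) = \<mu> * Re (x \<bullet>c x) - Re ((A *\<^sub>v x) \<bullet>c x)"
    if x: "x \<in> carrier_vec n" for x
  proof -
    have Ax: "A *\<^sub>v x \<in> carrier_vec n" using A x by simp
    have "B *\<^sub>v x = complex_of_real \<mu> \<cdot>\<^sub>v x - A *\<^sub>v x"
      unfolding B_def by (rule smult_one_minus_mult_mat_vec[OF A x])
    then have "(B *\<^sub>v x) \<bullet>c x = \<mu> * (x \<bullet>c x) - (A *\<^sub>v x) \<bullet>c x"
      using x Ax minus_scalar_prod_distrib[of "complex_of_real \<mu> \<cdot>\<^sub>v x" n "A *\<^sub>v x" "conjugate x"] by simp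
    then show ?thesis by simp
  qed
  have "det B = 0"
  proof (rule ccontr)
    assume "det B \<noteq> 0"
    moreover have "0 \<le> Re ((B *\<^sub>v x) \<bullet>c x)" if "x \<in> carrier_vec n" for x
      using form[OF that] \<mu>[OF that] by simp
    ultimately obtain e where e: "e > 0"
      "\<And>x. x \<in> carrier_vec n \<Longrightarrow> e * Re (x \<bullet>c x) \<le> Re ((B *\<^sub>v x) \<bullet>c x)"
      using psd_nonsingular_imp_coercive[OF B B_herm] by blast
    \<comment> \<open>Coercivity reads \<mu> (x, x) - (A x, x) \<ge> e (x, x), so the bound survives
      lowering \<mu> by \<open>e\<close>, against the choice of \<mu> as infimum.\<close>
    have "\<mu> - e \<in> S" unfolding S_def using e(2) form by (force simp: algebra_simps)
    then have "\<mu> \<le> \<mu> - e" unfolding \<mu>_def by (rule cInf_lower[OF _ bdd])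
    then show False using e(1) by simp
  qed
  then have "eigenvalue A (complex_of_real \<mu>)" unfolding B_def by (rule eigenvalue_of_det_eq_0[OF A])
  then have "\<mu> \<le> largest_eigenvalue A" using largest_eigenvalue_hermitian(2)[OF A n herm] by force
  then show ?thesis using \<mu>[OF x] Re_cscalar_prod_self_nonneg[of x]
    by (meson mult_right_mono order_trans)
qed

section \<open>Concavity of the logarithm\<close>

text \<open>Each \<open>ln (f i)\<close> lies below the tangent of \<open>ln\<close> at the mean
  \<open>m\<close>, and the linear parts \<open>f i / m - 1\<close> sum to zero precisely because
  \<open>m\<close> is the mean.\<close>

lemma sum_log_le_log_mean:
  fixes f :: "'a \<Rightarrow> real"
  assumes fin: "finite S" and ne: "S \<noteq> {}" and b: "1 < b" and pos: "\<And>i. i \<in> S \<Longrightarrow> 0 < f i"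
  shows "(\<Sum>i\<in>S. log b (f i)) \<le> card S * log b (sum f S / card S)"
proof -
  define m where "m = sum f S / card S"
  have c: "real (card S) > 0" using fin ne by (simp add: card_gt_0_iff)
  have m: "m > 0" unfolding m_def using c sum_pos[OF fin ne pos] by simp
  have "ln (f i) \<le> ln m + f i / m - 1" if "i \<in> S" for i
    using ln_le_minus_one[of "f i / m"] pos[OF that] m by (simp add: ln_div)
  then have "(\<Sum>i\<in>S. ln (f i)) \<le> (\<Sum>i\<in>S. ln m + f i / m - 1)" by (intro sum_mono)
  also have "\<dots> = card S * ln m + sum f S / m - card S"
    by (simp add: sum.distrib sum_subtractf sum_divide_distrib)
  also have "sum f S / m = card S" unfolding m_def using c m m_def by auto
  finally have "(\<Sum>i\<in>S. ln (f i)) \<le> card S * ln m" by simp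
  then show ?thesis
    using b unfolding m_def[symmetric] by (simp add: log_def sum_divide_distrib[symmetric] divide_right_mono)
qed

section \<open>The matrices \<open>G_mat\<close>, \<open>Q_mat\<close> and
  \<open>T_mat\<close>\<close>

lemma mat_adjoint_add_smult:
  fixes A B :: "complex mat" and r :: real
  assumes A: "A \<in> carrier_mat m n" and B: "B \<in> carrier_mat m n"
  shows "mat_adjoint (A + complex_of_real r \<cdot>\<^sub>m B)
    = mat_adjoint A + complex_of_real r \<cdot>\<^sub>m mat_adjoint B"
proof (rule eq_matI)
  note adj = mat_adjoint_carrier[OF A] mat_adjoint_carrier[OF B]
  fix i j assume "i < dim_row (mat_adjoint A + complex_of_real r \<cdot>\<^sub>m mat_adjoint B)"
    "j < dim_col (mat_adjoint A + complex_of_real r \<cdot>\<^sub>m mat_adjoint B)"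
  then have ij: "i < n" "j < m" using adj by auto
  show "mat_adjoint (A + complex_of_real r \<cdot>\<^sub>m B) $$ (i, j)
    = (mat_adjoint A + complex_of_real r \<cdot>\<^sub>m mat_adjoint B) $$ (i, j)"
    using A B adj ij by (simp add: mat_adjoint_index(2))
next
  have AB: "A + complex_of_real r \<cdot>\<^sub>m B \<in> carrier_mat m n" using A B by simp
  show "dim_row (mat_adjoint (A + complex_of_real r \<cdot>\<^sub>m B))
      = dim_row (mat_adjoint A + complex_of_real r \<cdot>\<^sub>m mat_adjoint B)"
    "dim_col (mat_adjoint (A + complex_of_real r \<cdot>\<^sub>m B))
      = dim_col (mat_adjoint A + complex_of_real r \<cdot>\<^sub>m mat_adjoint B)"
    using mat_adjoint_carrier[OF AB] mat_adjoint_carrier[OF B] by auto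
qed

lemma subarray_carrier: "subarray M H n \<in> carrier_mat M (dim_col H)"
  by (simp add: subarray_def)

lemma col_mat_carrier: "v \<in> carrier_vec m \<Longrightarrow> col_mat v \<in> carrier_mat m 1"
  by (auto simp: col_mat_def mat_of_cols_def)

text \<open>Exhibits the increment of \<open>Q_mat\<close> as a rank-one square with a single column
  \<open>U\<close>. Both the positivity of \<open>Q_mat\<close> and its determinant recursion start
  from this form.\<close>

lemma G_mat_eq:
  fixes H :: "complex mat" and w :: "nat \<Rightarrow> complex vec"
  assumes w: "w n \<in> carrier_vec M"
  defines "U \<equiv> mat_adjoint (subarray M H n) * col_mat (w n)"
  shows "G_mat M H w n = U * mat_adjoint U" and "U \<in> carrier_mat (dim_col H) 1"
proof -
  note F = subarray_carrier[of M H n] and C = col_mat_carrier[OF w]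
  note F' = mat_adjoint_carrier[OF F] and C' = mat_adjoint_carrier[OF C]
  show U: "U \<in> carrier_mat (dim_col H) 1" unfolding U_def using F' C by simp
  have "mat_adjoint U = mat_adjoint (col_mat (w n)) * subarray M H n"
    unfolding U_def mat_adjoint_mult[OF F' C] mat_adjoint_adjoint ..
  then show "G_mat M H w n = U * mat_adjoint U"
    unfolding G_mat_def using assoc_mult_mat[OF U C' F] by (simp add: U_def)
qed

text \<open>Each step adds \<rho> |U^H x|^2 \<ge> 0 to the form, which starts at (x, x). The
  explicit lower bound (x, x) passes unchanged through the induction and yields nonsingularity at
  once.\<close>

lemma Q_mat_positive_definite:
  assumes "0 \<le> \<rho>" and K: "dim_col H = K" and "\<And>m. m \<in> {1..n} \<Longrightarrow> w m \<in> carrier_vec M"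
  shows "Q_mat M K \<rho> H w n \<in> carrier_mat K K
    \<and> mat_adjoint (Q_mat M K \<rho> H w n) = Q_mat M K \<rho> H w n
    \<and> (\<forall>x \<in> carrier_vec K. Re (x \<bullet>c x) \<le> Re ((Q_mat M K \<rho> H w n *\<^sub>v x) \<bullet>c x))"
  using assms(3)
proof (induction n)
  case 0
  then show ?case by (simp add: mat_adjoint_one)
next
  case (Suc n)
  define Q where "Q = Q_mat M K \<rho> H w n"
  define U where "U = mat_adjoint (subarray M H (Suc n)) * col_mat (w (Suc n))"
  have Q: "Q \<in> carrier_mat K K" "mat_adjoint Q = Q"
    "\<And>x. x \<in> carrier_vec K \<Longrightarrow> Re (x \<bullet>c x) \<le> Re ((Q *\<^sub>v x) \<bullet>c x)"
    using Suc unfolding Q_def by auto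
  have U: "G_mat M H w (Suc n) = U * mat_adjoint U" "U \<in> carrier_mat K 1"
    using G_mat_eq[of w "Suc n" M H] Suc.prems K unfolding U_def by auto
  note U' = mat_adjoint_carrier[OF U(2)]
  have UU: "U * mat_adjoint U \<in> carrier_mat K K" using U U' by simp
  have step: "Q_mat M K \<rho> H w (Suc n) = Q + complex_of_real \<rho> \<cdot>\<^sub>m (U * mat_adjoint U)"
    using U(1) by (simp add: Q_def)
  have "Re (x \<bullet>c x) \<le> Re (((Q + complex_of_real \<rho> \<cdot>\<^sub>m (U * mat_adjoint U)) *\<^sub>v x) \<bullet>c x)"
    if x: "x \<in> carrier_vec K" for x
  proof -
    define y where "y = mat_adjoint U *\<^sub>v x"
    have y: "y \<in> carrier_vec 1" unfolding y_def using U' x by simp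
    have Qx: "Q *\<^sub>v x \<in> carrier_vec K" and Uy: "U *\<^sub>v y \<in> carrier_vec K" using Q U y x by auto
    have "(complex_of_real \<rho> \<cdot>\<^sub>m (U * mat_adjoint U)) *\<^sub>v x = complex_of_real \<rho> \<cdot>\<^sub>v (U *\<^sub>v y)"
      unfolding y_def assoc_mult_mat_vec[OF U(2) U' x, symmetric]
      by (rule eq_vecI) (use UU x in auto)
    then have "(Q + complex_of_real \<rho> \<cdot>\<^sub>m (U * mat_adjoint U)) *\<^sub>v x
      = Q *\<^sub>v x + complex_of_real \<rho> \<cdot>\<^sub>v (U *\<^sub>v y)"
      using add_mult_distrib_mat_vec[OF Q(1) _ x] UU by simp
    then have "((Q + complex_of_real \<rho> \<cdot>\<^sub>m (U * mat_adjoint U)) *\<^sub>v x) \<bullet>c x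
      = (Q *\<^sub>v x) \<bullet>c x + complex_of_real \<rho> * ((U *\<^sub>v y) \<bullet>c x)"
      using add_scalar_prod_distrib[of "Q *\<^sub>v x" K "complex_of_real \<rho> \<cdot>\<^sub>v (U *\<^sub>v y)" "conjugate x"]
        Qx Uy x by simp
    also have "(U *\<^sub>v y) \<bullet>c x = y \<bullet>c y"
      unfolding cscalar_prod_mult_mat_vec[OF U(2) y x] by (simp only: y_def)
    finally show ?thesis
      using Q(3)[OF x] mult_nonneg_nonneg[OF \<open>0 \<le> \<rho>\<close> Re_cscalar_prod_self_nonneg[of y]] by simp
  qed
  moreover have "mat_adjoint (Q + complex_of_real \<rho> \<cdot>\<^sub>m (U * mat_adjoint U))
    = Q + complex_of_real \<rho> \<cdot>\<^sub>m (U * mat_adjoint U)"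
    unfolding mat_adjoint_add_smult[OF Q(1) UU] Q(2) mat_adjoint_mult[OF U(2) U'] mat_adjoint_adjoint ..
  ultimately show ?case unfolding step using Q(1) UU by simp
qed

lemma coercive_imp_det_nonzero:
  fixes A :: "complex mat"
  assumes A: "A \<in> carrier_mat n n"
    and coercive: "\<forall>x \<in> carrier_vec n. Re (x \<bullet>c x) \<le> Re ((A *\<^sub>v x) \<bullet>c x)"
  shows "det A \<noteq> 0"
proof
  assume "det A = 0"
  then obtain v where v: "v \<in> carrier_vec n" "v \<noteq> 0\<^sub>v n" "A *\<^sub>v v = 0\<^sub>v n"
    using det_0_iff_vec_prod_zero[OF A] by blast
  have "Re (v \<bullet>c v) \<le> 0" using coercive v(1) v(3) by force
  then have "v \<bullet>c v = 0"
    using Re_cscalar_prod_self_nonneg[of v] by (simp add: cscalar_prod_self del: of_real_sum of_real_power)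
  then show False using v(1,2) by simp
qed

text \<open>Put F for the sub-array, Q for the preceding \<open>Q_mat\<close> and x = Q^(-1) F^H y.
  Then (T y, y) = (F x, y) = (x, Q x), so positivity is inherited from Q. Only the combining vectors
  before index \<open>n\<close> enter, as \<open>T_mat\<close> is built from \<open>Q_mat\<close> at
  \<open>n - 1\<close>.\<close>

lemma T_mat_hermitian_psd:
  assumes "0 \<le> \<rho>" and K: "dim_col H = K" and w: "\<And>m. m \<in> {1..<n} \<Longrightarrow> w m \<in> carrier_vec M"
  shows "T_mat M K \<rho> H w n \<in> carrier_mat M M"
    and "mat_adjoint (T_mat M K \<rho> H w n) = T_mat M K \<rho> H w n"
    and "\<And>y. y \<in> carrier_vec M \<Longrightarrow> 0 \<le> Re ((T_mat M K \<rho> H w n *\<^sub>v y) \<bullet>c y)"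
proof -
  define Q where "Q = Q_mat M K \<rho> H w (n - 1)"
  define F where "F = subarray M H n"
  define B where "B = the (mat_inverse Q)"
  have Q: "Q \<in> carrier_mat K K" "mat_adjoint Q = Q"
    "\<forall>x \<in> carrier_vec K. Re (x \<bullet>c x) \<le> Re ((Q *\<^sub>v x) \<bullet>c x)"
    using Q_mat_positive_definite[OF assms(1) K w, of "n - 1"] unfolding Q_def by force+
  note inv = nonsingular_mat_inverse[OF Q(1) coercive_imp_det_nonzero[OF Q(1,3)], folded B_def]
  have F: "F \<in> carrier_mat M K" unfolding F_def using subarray_carrier[of M H n] K by simp
  note F' = mat_adjoint_carrier[OF F]
  have FB: "F * B \<in> carrier_mat M K" using F inv by simp
  have B_herm: "mat_adjoint B = B" by (rule hermitian_inverse[OF Q(1,2) inv])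
  have T_eq: "T_mat M K \<rho> H w n = F * B * mat_adjoint F"
    by (simp add: T_mat_def F_def B_def Q_def)
  show T: "T_mat M K \<rho> H w n \<in> carrier_mat M M" unfolding T_eq using FB F' by simp
  show "mat_adjoint (T_mat M K \<rho> H w n) = T_mat M K \<rho> H w n"
    unfolding T_eq mat_adjoint_mult[OF FB F'] mat_adjoint_mult[OF F inv(1)] mat_adjoint_adjoint B_herm
    by (rule assoc_mult_mat[OF F inv(1) F', symmetric])
  fix y :: "complex vec" assume y: "y \<in> carrier_vec M"
  define z where "z = mat_adjoint F *\<^sub>v y"
  have z: "z \<in> carrier_vec K" unfolding z_def using F' y by simp
  define x where "x = B *\<^sub>v z"
  have x: "x \<in> carrier_vec K" unfolding x_def using inv z by simp
  have Qx: "Q *\<^sub>v x = z"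
    unfolding x_def using assoc_mult_mat_vec[OF Q(1) inv(1) z] inv(2) z by simp
  have "T_mat M K \<rho> H w n *\<^sub>v y = F *\<^sub>v x"
    unfolding T_eq x_def z_def assoc_mult_mat_vec[OF FB F' y]
    using assoc_mult_mat_vec[OF F inv(1) z] unfolding z_def .
  then have "(T_mat M K \<rho> H w n *\<^sub>v y) \<bullet>c y = x \<bullet>c (Q *\<^sub>v x)"
    unfolding Qx z_def using cscalar_prod_mult_mat_vec[OF F x y] by simp
  also have "\<dots> = (Q *\<^sub>v x) \<bullet>c x"
    using cscalar_prod_mult_mat_vec[OF Q(1) x x] Q(2) by simp
  finally show "0 \<le> Re ((T_mat M K \<rho> H w n *\<^sub>v y) \<bullet>c y)"
    using Q(3) x Re_cscalar_prod_self_nonneg[of x] by force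
qed

section \<open>The determinant recursion and the rate\<close>

text \<open>The update is U U^H with one column U = F^H w, so the second factor in
  \<open>det_add_smult_mult\<close> is a 1 by 1 determinant. Regrouping U^H Q^(-1) U = w^H (F Q^(-1)
  F^H) w brings in T.\<close>

lemma det_Q_mat_Suc:
  assumes "0 \<le> \<rho>" and K: "dim_col H = K" and w: "\<And>m. m \<in> {1..Suc n} \<Longrightarrow> w m \<in> carrier_vec M"
  shows "det (Q_mat M K \<rho> H w (Suc n)) = det (Q_mat M K \<rho> H w n)
    * (1 + complex_of_real \<rho> * ((T_mat M K \<rho> H w (Suc n) *\<^sub>v w (Suc n)) \<bullet>c w (Suc n)))"
proof -
  define Q where "Q = Q_mat M K \<rho> H w n"
  define F where "F = subarray M H (Suc n)"
  define B where "B = the (mat_inverse Q)"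
  define C where "C = col_mat (w (Suc n))"
  define T where "T = T_mat M K \<rho> H w (Suc n)"
  define U where "U = mat_adjoint F * C"
  have Q: "Q \<in> carrier_mat K K" "\<forall>x \<in> carrier_vec K. Re (x \<bullet>c x) \<le> Re ((Q *\<^sub>v x) \<bullet>c x)"
    using Q_mat_positive_definite[OF assms(1) K, of n w M] w unfolding Q_def by auto
  note inv = nonsingular_mat_inverse[OF Q(1) coercive_imp_det_nonzero[OF Q], folded B_def]
  have wn: "w (Suc n) \<in> carrier_vec M" using w by simp
  have F: "F \<in> carrier_mat M K" unfolding F_def using subarray_carrier[of M H "Suc n"] K by simp
  have C: "C \<in> carrier_mat M 1" unfolding C_def by (rule col_mat_carrier[OF wn])
  note F' = mat_adjoint_carrier[OF F] and C' = mat_adjoint_carrier[OF C]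
  have U: "G_mat M H w (Suc n) = U * mat_adjoint U" "U \<in> carrier_mat K 1"
    using G_mat_eq[of w "Suc n" M H] wn K unfolding U_def F_def C_def by auto
  note U' = mat_adjoint_carrier[OF U(2)]
  have FB: "F * B \<in> carrier_mat M K" using F inv by simp
  have T: "T = F * B * mat_adjoint F" "T \<in> carrier_mat M M"
    unfolding T_def T_mat_def F_def B_def Q_def using F FB F'
    by (simp_all add: F_def B_def Q_def)
  have "mat_adjoint U * B * U = mat_adjoint C * F * B * (mat_adjoint F * C)"
    unfolding U_def mat_adjoint_mult[OF F' C] mat_adjoint_adjoint ..
  also have "mat_adjoint C * F * B = mat_adjoint C * (F * B)"
    by (rule assoc_mult_mat[OF C' F inv(1)])
  also have "mat_adjoint C * (F * B) * (mat_adjoint F * C) = mat_adjoint C * (F * B * (mat_adjoint F * C))"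
    by (rule assoc_mult_mat[OF C' FB mult_carrier_mat[OF F' C]])
  also have "F * B * (mat_adjoint F * C) = T * C"
    unfolding T(1) by (rule assoc_mult_mat[OF FB F' C, symmetric])
  finally have UBU: "mat_adjoint U * B * U = mat_adjoint C * (T * C)" .
  have colC: "col C 0 = w (Suc n)"
    unfolding C_def col_mat_def by simp
  \<comment> \<open>Since \<open>\<bullet>c\<close> conjugates its second argument, w^H T w is the
    product with \<open>T *\<^sub>v w (Suc n)\<close> on the left.\<close>
  have "(mat_adjoint C * (T * C)) $$ (0, 0) = (\<Sum>i<M. cnj (w (Suc n) $ i) * (T *\<^sub>v w (Suc n)) $ i)"
    using C C' T(2) wn colC
    by (auto simp: scalar_prod_def[of "row _ _"] atLeast0LessThan mat_adjoint_index(2) C_def col_mat_def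
        mat_of_cols_index intro!: sum.cong)
  also have "\<dots> = (T *\<^sub>v w (Suc n)) \<bullet>c w (Suc n)"
    using wn by (simp add: scalar_prod_def[of _ "conjugate _"] atLeast0LessThan mult.commute)
  finally have entry: "(mat_adjoint U * B * U) $$ (0, 0) = (T *\<^sub>v w (Suc n)) \<bullet>c w (Suc n)"
    unfolding UBU .
  have "det (Q_mat M K \<rho> H w (Suc n)) = det (Q + complex_of_real \<rho> \<cdot>\<^sub>m (U * mat_adjoint U))"
    using U(1) by (simp add: Q_def)
  also have "\<dots> = det Q * det (1\<^sub>m 1 + complex_of_real \<rho> \<cdot>\<^sub>m (mat_adjoint U * B * U))"
    by (rule det_add_smult_mult[OF Q(1) inv(1,2) U(2) U'])
  also have "det (1\<^sub>m 1 + complex_of_real \<rho> \<cdot>\<^sub>m (mat_adjoint U * B * U))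
    = 1 + complex_of_real \<rho> * ((T *\<^sub>v w (Suc n)) \<bullet>c w (Suc n))"
    using U(2) U' inv(1) entry by (subst det_single) auto
  finally show ?thesis unfolding Q_def T_def .
qed

lemma det_Q_mat:
  assumes "0 \<le> \<rho>" and "dim_col H = K" and "\<And>m. m \<in> {1..n} \<Longrightarrow> w m \<in> carrier_vec M"
  shows "det (Q_mat M K \<rho> H w n)
    = (\<Prod>m = 1..n. 1 + complex_of_real \<rho> * ((T_mat M K \<rho> H w m *\<^sub>v w m) \<bullet>c w m))"
  using assms(3)
proof (induction n)
  case (Suc n)
  then show ?case using det_Q_mat_Suc[OF assms(1,2), of n w M] by simp
qed simp

text \<open>Column n of the combiner is supported on one block of rows, so each row of W^H H
  involves a single sub-array. Hence H^H W W^H H is the sum of the rank-one matrices G_n, the sum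
  that the recursion for \<open>Q_mat\<close> accumulates.\<close>

lemma Q_mat_eq_combiner:
  assumes H: "H \<in> carrier_mat (N * M) K" and w: "\<And>m. m \<in> {1..N} \<Longrightarrow> w m \<in> carrier_vec M"
  shows "Q_mat M K \<rho> H w N = 1\<^sub>m K + complex_of_real \<rho> \<cdot>\<^sub>m
    (mat_adjoint H * combiner M N w * mat_adjoint (combiner M N w) * H)"
proof -
  \<comment> \<open>The row vector w^H F of the sub-array numbered \<open>Suc n\<close>; here
    \<open>n\<close> counts from 0, like the columns of the combiner.\<close>
  define v where "v n j = (\<Sum>i<M. cnj (w (Suc n) $ i) * H $$ (M * n + i, j))" for n j
  define W where "W = combiner M N w"
  have W: "W \<in> carrier_mat (N * M) N" unfolding W_def combiner_def by simp
  note H' = mat_adjoint_carrier[OF H] and W' = mat_adjoint_carrier[OF W]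
  have WH: "(mat_adjoint W * H) $$ (n, j) = v n j" if n: "n < N" and j: "j < K" for n j
  proof -
    have "Suc n * M \<le> N * M" using n by (intro mult_right_mono) auto
    then have le: "M * n + M \<le> N * M" by (simp add: algebra_simps)
    have "(mat_adjoint W * H) $$ (n, j) = (\<Sum>r<N * M. cnj (W $$ (r, n)) * H $$ (r, j))"
      using H W W' n j by (auto simp: scalar_prod_def atLeast0LessThan mat_adjoint_index(2) intro!: sum.cong)
    \<comment> \<open>Outside this block column \<open>n\<close> of \<open>W\<close> vanishes;
      \<open>le\<close> ensures that the block lies within the rows of \<open>W\<close>.\<close>
    also have "\<dots> = (\<Sum>r\<in>{M * n..<M * n + M}. cnj (W $$ (r, n)) * H $$ (r, j))"
      by (rule sum.mono_neutral_right) (use le n in \<open>auto simp: W_def combiner_def\<close>)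
    also have "\<dots> = (\<Sum>r\<in>{M * n..<M * n + M}. cnj (w (Suc n) $ (r - M * n)) * H $$ (r, j))"
      by (rule sum.cong) (use le n in \<open>auto simp: W_def combiner_def\<close>)
    also have "\<dots> = v n j"
      unfolding v_def by (rule sum.reindex_bij_witness[of _ "\<lambda>i. M * n + i" "\<lambda>r. r - M * n"]) auto
    finally show ?thesis .
  qed
  have WH_carrier: "mat_adjoint W * H \<in> carrier_mat N K" using W' H by simp
  have assoc: "mat_adjoint H * W * mat_adjoint W * H = mat_adjoint (mat_adjoint W * H) * (mat_adjoint W * H)"
    unfolding mat_adjoint_mult[OF W' H] mat_adjoint_adjoint
    by (rule assoc_mult_mat[OF mult_carrier_mat[OF H' W] W' H])
  have HWWH: "(mat_adjoint H * W * mat_adjoint W * H) $$ (k, l) = (\<Sum>n<N. cnj (v n k) * v n l)"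
    if kl: "k < K" "l < K" for k l
  proof -
    define P where "P = mat_adjoint W * H"
    have P: "P \<in> carrier_mat N K" unfolding P_def by (rule WH_carrier)
    have "(mat_adjoint P * P) $$ (k, l) = (\<Sum>n<N. cnj (P $$ (n, k)) * P $$ (n, l))"
      using P mat_adjoint_carrier[OF P] kl
      by (auto simp: scalar_prod_def atLeast0LessThan mat_adjoint_index(2) intro!: sum.cong)
    also have "\<dots> = (\<Sum>n<N. cnj (v n k) * v n l)"
      unfolding P_def by (rule sum.cong) (use WH kl in simp_all)
    finally show ?thesis using assoc unfolding P_def by simp
  qed
  have G: "G_mat M H w (Suc n) \<in> carrier_mat K K"
    "\<And>k l. k < K \<Longrightarrow> l < K \<Longrightarrow> G_mat M H w (Suc n) $$ (k, l) = cnj (v n k) * v n l"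
    if n: "n < N" for n
  proof -
    define F where "F = subarray M H (Suc n)"
    define C where "C = col_mat (w (Suc n))"
    define U where "U = mat_adjoint F * C"
    have wn: "w (Suc n) \<in> carrier_vec M" using w n by simp
    have U: "G_mat M H w (Suc n) = U * mat_adjoint U" "U \<in> carrier_mat K 1"
      using G_mat_eq[of w "Suc n" M H] wn H unfolding U_def F_def C_def by auto
    note U' = mat_adjoint_carrier[OF U(2)]
    show "G_mat M H w (Suc n) \<in> carrier_mat K K" unfolding U(1) using U(2) U' by simp
    have F: "F \<in> carrier_mat M K" unfolding F_def using subarray_carrier[of M H "Suc n"] H by simp
    have C: "C \<in> carrier_mat M 1" unfolding C_def by (rule col_mat_carrier[OF wn])
    have Uk: "U $$ (k, 0) = cnj (v n k)" if k: "k < K" for k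
      using F C mat_adjoint_carrier[OF F] k wn H
      by (auto simp: U_def v_def scalar_prod_def atLeast0LessThan mat_adjoint_index(2) mult.commute
          F_def C_def subarray_def col_mat_def mat_of_cols_index intro!: sum.cong)
    fix k l assume kl: "k < K" "l < K"
    have "(U * mat_adjoint U) $$ (k, l) = U $$ (k, 0) * cnj (U $$ (l, 0))"
      using U(2) U' kl by (simp add: scalar_prod_def mat_adjoint_index(2))
    then show "G_mat M H w (Suc n) $$ (k, l) = cnj (v n k) * v n l"
      unfolding U(1) by (simp add: Uk kl)
  qed
  \<comment> \<open>The guard \<open>n \<le> N\<close> is part of the induction because
    \<open>G\<close> is available only for indices below \<open>N\<close>.\<close>
  have Q: "n \<le> N \<Longrightarrow> Q_mat M K \<rho> H w n \<in> carrier_mat K K \<and> (\<forall>k<K. \<forall>l<K.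
      Q_mat M K \<rho> H w n $$ (k, l) = (if k = l then 1 else 0) + \<rho> * (\<Sum>m<n. cnj (v m k) * v m l))" for n
  proof (induction n)
    case (Suc n)
    then show ?case using G[of n] by (auto simp: algebra_simps)
  qed simp
  have carr: "mat_adjoint H * W * mat_adjoint W * H \<in> carrier_mat K K"
    by (rule mult_carrier_mat[OF mult_carrier_mat[OF mult_carrier_mat[OF H' W] W'] H])
  show ?thesis unfolding W_def[symmetric]
  proof (rule eq_matI)
    fix k l assume "k < dim_row (1\<^sub>m K + complex_of_real \<rho> \<cdot>\<^sub>m (mat_adjoint H * W * mat_adjoint W * H))"
      "l < dim_col (1\<^sub>m K + complex_of_real \<rho> \<cdot>\<^sub>m (mat_adjoint H * W * mat_adjoint W * H))"
    then have kl: "k < K" "l < K" using carr by auto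
    have "(1\<^sub>m K + complex_of_real \<rho> \<cdot>\<^sub>m X) $$ (k, l) = (1\<^sub>m K) $$ (k, l) + \<rho> * X $$ (k, l)"
      if "X \<in> carrier_mat K K" for X :: "complex mat"
      using that kl by simp
    note this[OF carr]
    then show "Q_mat M K \<rho> H w N $$ (k, l)
      = (1\<^sub>m K + complex_of_real \<rho> \<cdot>\<^sub>m (mat_adjoint H * W * mat_adjoint W * H)) $$ (k, l)"
      using Q[of N] HWWH[OF kl] kl by simp
  qed (use Q[of N] H H' in auto)
qed

section \<open>The two inequalities and their equality cases\<close>

theorem mainTheorem2:
  fixes N M K Nr :: nat and \<rho> :: real
    and H :: "complex mat" and w :: "nat \<Rightarrow> complex vec"
  assumes "0 < N" and "0 < M" and "0 < K" and "N = K"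
    and "Nr = N * M" and "N < Nr"
    and "0 < \<rho>"
    and "H \<in> carrier_mat Nr K"
    and "\<And>n. n \<in> {1..N} \<Longrightarrow> w n \<in> carrier_vec M"
    and "\<And>n i. n \<in> {1..N} \<Longrightarrow> i < M \<Longrightarrow> cmod (w n $ i) = 1 / sqrt (real M)"
  shows "rate_ESA M N K \<rho> H w \<le> (\<Sum>n = 1..N. log 2 (1 + \<rho> * sigma1 M K \<rho> H w n))
    \<and> (\<Sum>n = 1..N. log 2 (1 + \<rho> * sigma1 M K \<rho> H w n))
        \<le> real N * log 2 (1 + \<rho> / real N * (\<Sum>n = 1..N. sigma1 M K \<rho> H w n))
    \<and> ((\<forall>n \<in> {1..N}. w n \<bullet>c w n = 1 \<and>
            eigenvector (T_mat M K \<rho> H w n) (w n) (complex_of_real (sigma1 M K \<rho> H w n)))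
        \<longrightarrow> rate_ESA M N K \<rho> H w = (\<Sum>n = 1..N. log 2 (1 + \<rho> * sigma1 M K \<rho> H w n)))
    \<and> ((\<forall>m \<in> {1..N}. \<forall>n \<in> {1..N}. sigma1 M K \<rho> H w m = sigma1 M K \<rho> H w n)
        \<longrightarrow> (\<Sum>n = 1..N. log 2 (1 + \<rho> * sigma1 M K \<rho> H w n))
          = real N * log 2 (1 + \<rho> / real N * (\<Sum>n = 1..N. sigma1 M K \<rho> H w n)))"
proof -
  have K: "dim_col H = K" and \<rho>: "0 \<le> \<rho>" and H: "H \<in> carrier_mat (N * M) K" using assms by auto
  define T where "T n = T_mat M K \<rho> H w n" for n
  \<comment> \<open>The form w_n^H T_n w_n, real because T_n is Hermitian. Its nonnegativity keeps
    every factor 1 + \<rho> \<gamma> n positive, so that the logarithm of the product splits and is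
    monotone in each factor.\<close>
  define \<gamma> where "\<gamma> n = Re ((T n *\<^sub>v w n) \<bullet>c w n)" for n
  define \<sigma> where "\<sigma> n = sigma1 M K \<rho> H w n" for n
  have T: "T n \<in> carrier_mat M M" "mat_adjoint (T n) = T n"
    and psd: "\<And>y. y \<in> carrier_vec M \<Longrightarrow> 0 \<le> Re ((T n *\<^sub>v y) \<bullet>c y)" if "n \<in> {1..N}" for n
    using T_mat_hermitian_psd[OF \<rho> K, of n w M] assms(9) that unfolding T_def by auto
  \<comment> \<open>There are \<open>M\<close> entries, each of squared modulus 1 / M.\<close>
  have unit: "w n \<bullet>c w n = 1" if n: "n \<in> {1..N}" for n
    using assms(2) assms(9)[OF n] assms(10)[OF n]
    by (simp add: cscalar_prod_self power_divide del: of_real_sum of_real_power)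
  have \<gamma>: "0 \<le> \<gamma> n" "\<gamma> n \<le> \<sigma> n" "(T n *\<^sub>v w n) \<bullet>c w n = complex_of_real (\<gamma> n)"
    if n: "n \<in> {1..N}" for n
  proof -
    show "0 \<le> \<gamma> n" unfolding \<gamma>_def by (rule psd[OF n assms(9)[OF n]])
    show "\<gamma> n \<le> \<sigma> n"
      using hermitian_form_le_largest_eigenvalue[OF T(1)[OF n] assms(2) T(2)[OF n] assms(9)[OF n]]
        unit[OF n] unfolding \<gamma>_def \<sigma>_def sigma1_def T_def by simp
    show "(T n *\<^sub>v w n) \<bullet>c w n = complex_of_real (\<gamma> n)"
      unfolding \<gamma>_def by (rule hermitian_form_real[OF T(1)[OF n] T(2)[OF n] assms(9)[OF n]])
  qed
  have pos: "0 < 1 + \<rho> * \<gamma> n" "1 + \<rho> * \<gamma> n \<le> 1 + \<rho> * \<sigma> n" if n: "n \<in> {1..N}" for n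
    using mult_nonneg_nonneg[OF \<rho> \<gamma>(1)[OF n]] mult_left_mono[OF \<gamma>(2)[OF n] \<rho>] by auto
  have "det (Q_mat M K \<rho> H w N) = (\<Prod>n = 1..N. 1 + complex_of_real \<rho> * ((T n *\<^sub>v w n) \<bullet>c w n))"
    unfolding T_def by (rule det_Q_mat[OF \<rho> K]) (rule assms(9))
  also have "\<dots> = complex_of_real (\<Prod>n = 1..N. 1 + \<rho> * \<gamma> n)"
    unfolding of_real_prod by (rule prod.cong) (use \<gamma>(3) in auto)
  finally have "det (Q_mat M K \<rho> H w N) = complex_of_real (\<Prod>n = 1..N. 1 + \<rho> * \<gamma> n)" .
  moreover have "Q_mat M K \<rho> H w N = 1\<^sub>m K + complex_of_real \<rho> \<cdot>\<^sub>m
      (mat_adjoint H * combiner M N w * mat_adjoint (combiner M N w) * H)"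
    by (rule Q_mat_eq_combiner[OF H]) (rule assms(9))
  ultimately have "rate_ESA M N K \<rho> H w = log 2 (\<Prod>n = 1..N. 1 + \<rho> * \<gamma> n)"
    unfolding rate_ESA_def by (metis Re_complex_of_real)
  also have "\<dots> = (\<Sum>n = 1..N. log 2 (1 + \<rho> * \<gamma> n))"
    unfolding log_def by (subst ln_prod) (use pos(1) in \<open>force simp: sum_divide_distrib\<close>)+
  finally have rate: "rate_ESA M N K \<rho> H w = (\<Sum>n = 1..N. log 2 (1 + \<rho> * \<gamma> n))" .
  have first: "rate_ESA M N K \<rho> H w \<le> (\<Sum>n = 1..N. log 2 (1 + \<rho> * \<sigma> n))"
    unfolding rate
  proof (rule sum_mono)
    fix n assume "n \<in> {1..N}"
    then show "log 2 (1 + \<rho> * \<gamma> n) \<le> log 2 (1 + \<rho> * \<sigma> n)"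
      using pos[of n] by (subst log_le_cancel_iff) linarith+
  qed
  \<comment> \<open>The mean of the arguments 1 + \<rho> \<sigma> n is the argument on the right of
    the second inequality.\<close>
  have mean: "(\<Sum>n = 1..N. 1 + \<rho> * \<sigma> n) / N = 1 + \<rho> / N * (\<Sum>n = 1..N. \<sigma> n)"
    using assms(1) by (simp add: sum.distrib sum_distrib_left[symmetric] field_simps)
  have "0 < 1 + \<rho> * \<sigma> n" if "n \<in> {1..N}" for n
    using pos[OF that] by linarith
  then have "(\<Sum>n = 1..N. log 2 (1 + \<rho> * \<sigma> n))
      \<le> card {1..N} * log 2 ((\<Sum>n = 1..N. 1 + \<rho> * \<sigma> n) / card {1..N})"
    using assms(1) by (intro sum_log_le_log_mean) auto
  then have second: "(\<Sum>n = 1..N. log 2 (1 + \<rho> * \<sigma> n)) \<le> N * log 2 (1 + \<rho> / N * (\<Sum>n = 1..N. \<sigma> n))"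
    unfolding card_atLeastAtMost by (simp only: mean add_diff_cancel_right' Suc_eq_plus1)
  have eq_first: "rate_ESA M N K \<rho> H w = (\<Sum>n = 1..N. log 2 (1 + \<rho> * \<sigma> n))"
    if ev: "\<forall>n \<in> {1..N}. w n \<bullet>c w n = 1 \<and> eigenvector (T n) (w n) (complex_of_real (\<sigma> n))"
  proof -
    \<comment> \<open>At a unit eigenvector the form takes the eigenvalue as its value, so the
      Rayleigh bound is attained in every summand.\<close>
    have "\<gamma> n = \<sigma> n" if n: "n \<in> {1..N}" for n
    proof -
      have "T n *\<^sub>v w n = complex_of_real (\<sigma> n) \<cdot>\<^sub>v w n"
        using ev n unfolding eigenvector_def by blast
      then show ?thesis using assms(9)[OF n] unit[OF n] by (simp add: \<gamma>_def)
    qed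
    then show ?thesis unfolding rate by simp
  qed
  have eq_second: "(\<Sum>n = 1..N. log 2 (1 + \<rho> * \<sigma> n)) = N * log 2 (1 + \<rho> / N * (\<Sum>n = 1..N. \<sigma> n))"
    if eq: "\<forall>m \<in> {1..N}. \<forall>n \<in> {1..N}. \<sigma> m = \<sigma> n"
  proof -
    obtain c where "\<sigma> n = c" if "n \<in> {1..N}" for n using eq by blast
    then have "(\<Sum>n = 1..N. \<sigma> n) = N * c"
      "(\<Sum>n = 1..N. log 2 (1 + \<rho> * \<sigma> n)) = N * log 2 (1 + \<rho> * c)"
      by simp_all
    then show ?thesis using assms(1) by simp
  qed
  show ?thesis
    using first second eq_first eq_second unfolding \<sigma>_def T_def by blast
qed

end
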